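(* Let $G=(V,E)$ be a finite connected simple graph, let $\mu$ be a Bernoulli bond percolation measure on $\Omega=\{0,1\}^E$, and let $C_1,C_2$ be independent configurations each distributed as $\mu$. Let a decision tree $T$ build a set $S=S(C_1,C_2)$, and let $A,B\subseteq\Omega$ be two closed upward events. Then $$\mathbf{P}(A\,\square_S\,B)\le\mathbf{P}(A)\,\mathbf{P}(B),$$ where $\mathbf{P}(A\,\square_S\,B)$ is the probability that $(C_1,C_2)\in A\,\square_S\,B$, and $\mathbf{P}(A)=\mu(A)$, $\mathbf{P}(B)=\mu(B)$.
   Context: $\mu$ is the product measure on $\Omega=\{0,1\}^E$ in which edge $e$ is open (value 1) with probability $p_e\in[0,1]$. An event $A\subseteq\Omega$ is closed upward if $C\in A$ and $C\le C'$ coordinatewise imply $C'\in A$. For configurations $C_1,C_2$ and $S\subseteq E$, $C_1\to_S C_2$ is the configuration equal to $C_1(e)$ for $e\in S$ and to $C_2(e)$ for $e\in\overline S=E\setminus S$. A witness of an event $A$ in a configuration $C$ is a set $I\subseteq E$ such that every configuration $C'$ agreeing with $C$ on $I$ belongs to $A$. The event $A\,\square_S\,B$ is the set of pairs $(C_1,C_2)\in\Omega\times\Omega$ for which there exist $I,J\subseteq E$ such that $I$ is a witness of $A$ in $C_1$, $J$ is a witness of $B$ in $C_1\to_S C_2$, and $I\cap J\subseteq\overline S$, where $S=S(C_1,C_2)$. Decision tree: a finite rooted tree (root $N_0$) whose nodes are decision nodes or leaf nodes. Each node $N$ carries an edge $e\in E$ that it queries and a decision in $\{\text{“}S\text{”},\text{“}\overline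 S\text{”}\}$; each decision node has four children indexed by $00,01,10,11$; the nodes on every path from the root query pairwise distinct edges. Given $(C_1,C_2)$, start at the root; at each visited node with edge $e$, put $e$ into $S$ if the decision is “$S$” and into $\overline S$ otherwise, reveal $C_1(e)$ and $C_2(e)$, and (at a decision node) move to the child indexed by $C_1(e)C_2(e)$; stop after processing a leaf node. Edges never queried belong to $\overline S$. The resulting set $S(C_1,C_2)\subseteq E$ is the set built by the tree. *)

theory Defs
  imports "HOL-Probability.Probability"
begin

definition simple_graph :: "'v set \<Rightarrow> 'v set set \<Rightarrow> bool" where
  "simple_graph V E \<longleftrightarrow> (\<forall>e\<in>E. e \<subseteq> V \<and> card e = 2)"

definition connected_graph :: "'v set \<Rightarrow> 'v set set \<Rightarrow> bool" where
  "connected_graph V E \<longleftrightarrow>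
     V \<noteq> {} \<and> (\<forall>u\<in>V. \<forall>v\<in>V. (u, v) \<in> {(x, y). {x, y} \<in> E}\<^sup>*)"

type_synonym 'e config = "'e \<Rightarrow> bool"

text \<open>
  Configurations on \<open>E\<close> are total functions that are normalised to \<open>False\<close> outside \<open>E\<close>, so that
  \<open>configs E\<close> is in bijection with \<open>{0,1}\<^sup>E\<close>. This is the same normalisation as the one
  used by \<^const>\<open>Pi_pmf\<close>. The pointwise order on functions, restricted to \<open>configs E\<close>,
  is the coordinatewise order.
\<close>
definition configs :: "'e set \<Rightarrow> 'e config set" where
  "configs E = {C. \<forall>e. e \<notin> E \<longrightarrow> C e = False}"

definition percolation :: "'e set \<Rightarrow> ('e \<Rightarrow> real) \<Rightarrow> 'e config pmf" where
  "percolation E p = Pi_pmf E False (\<lambda>e. bernoulli_pmf (p e))"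

definition closed_upward :: "'e set \<Rightarrow> 'e config set \<Rightarrow> bool" where
  "closed_upward E A \<longleftrightarrow> (\<forall>C\<in>A. \<forall>C'\<in>configs E. C \<le> C' \<longrightarrow> C' \<in> A)"

definition splice :: "'e set \<Rightarrow> 'e config \<Rightarrow> 'e config \<Rightarrow> 'e config" where
  "splice S C1 C2 = (\<lambda>e. if e \<in> S then C1 e else C2 e)"

definition witness :: "'e set \<Rightarrow> 'e config set \<Rightarrow> 'e config \<Rightarrow> 'e set \<Rightarrow> bool" where
  "witness E A C I \<longleftrightarrow>
     I \<subseteq> E \<and> (\<forall>C'\<in>configs E. (\<forall>e\<in>I. C' e = C e) \<longrightarrow> C' \<in> A)"

definition box_event :: "'e set \<Rightarrow> ('e config \<Rightarrow> 'e config \<Rightarrow> 'e set)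
    \<Rightarrow> 'e config set \<Rightarrow> 'e config set \<Rightarrow> ('e config \<times> 'e config) set" where
  "box_event E S A B = {(C1, C2). C1 \<in> configs E \<and> C2 \<in> configs E \<and>
     (\<exists>I J. witness E A C1 I \<and> witness E B (splice (S C1 C2) C1 C2) J \<and>
            I \<inter> J \<subseteq> E - S C1 C2)}"

datatype decision = To_S | To_Compl

text \<open>
  The child of a decision node indexed by \<open>ab\<close> is the value of the function at \<open>(a, b)\<close>,
  where \<open>True\<close> stands for 1.
\<close>
datatype 'e query_tree =
    Leaf 'e decision
  | Decision 'e decision "bool \<times> bool \<Rightarrow> 'e query_tree"

text \<open>The sequences of edges queried along the paths from the root to the leaves.\<close>
primrec root_paths :: "'e query_tree \<Rightarrow> 'e list set" where
  "root_paths (Leaf e d) = {[e]}"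
| "root_paths (Decision e d ch) = (\<Union>r. (#) e ` root_paths (ch r))"

definition decision_tree :: "'e set \<Rightarrow> 'e query_tree \<Rightarrow> bool" where
  "decision_tree E T \<longleftrightarrow> (\<forall>es\<in>root_paths T. set es \<subseteq> E \<and> distinct es)"

primrec built_set :: "'e query_tree \<Rightarrow> 'e config \<Rightarrow> 'e config \<Rightarrow> 'e set" where
  "built_set (Leaf e d) C1 C2 = (if d = To_S then {e} else {})"
| "built_set (Decision e d ch) C1 C2 =
     (if d = To_S then {e} else {}) \<union> built_set (ch (C1 e, C2 e)) C1 C2"

end

theory Submission
  imports Defs
begin

text \<open>
  For a constant set \<open>S\<close>, removing one edge \<open>e\<close> from \<open>S\<close> can only
  increase the probability of \<open>A \<box>\<^sub>S B\<close>. This is the doubling step in the proof of the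
  van den Berg--Kesten inequality: as long as \<open>e\<close> lies in \<open>S\<close>, the witnesses of
  \<open>A\<close> and of \<open>B\<close> compete for the single value \<open>C\<^sub>1(e)\<close>, whereas afterwards
  \<open>A\<close> reads \<open>C\<^sub>1(e)\<close> and \<open>B\<close> reads the independent value \<open>C\<^sub>2(e)\<close>.
  Freeze both configurations off \<open>e\<close> and look at the two values at \<open>e\<close>. Since the events
  are increasing, a closed edge is useless to a witness, so there are only three cases. If the box
  event for \<open>S \<union> {e}\<close> occurs with \<open>e\<close> closed in \<open>C\<^sub>1\<close>, no witness needs
  \<open>e\<close>, and the event for \<open>S\<close> occurs whatever the two values are. If it occurs only with
  \<open>e\<close> open in \<open>C\<^sub>1\<close>, then at most one of the two witnesses uses \<open>e\<close>, so the event
  for \<open>S\<close> is implied by \<open>C\<^sub>1(e) = 1\<close> alone or by \<open>C\<^sub>2(e) = 1\<close> alone; each of these has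
  the same probability \<open>p\<^sub>e\<close>. Otherwise there is nothing to prove. This argument is carried by
  \<open>static_box_unshare_closed_edge\<close>, \<open>static_box_unshare_open_edge\<close>
  and \<open>fibre_prob_le\<close>.

  A decision tree is dismantled from the leaves upwards (\<open>box_tree_le_static_box\<close>). Fix the
  answers on the path to a node. The set built before the node is then constant, and by induction
  the subtree below may be discarded, so that the set after the node is constant as well. What
  remains is one edge to remove, which no longer depends on its own answer; the case above applies
  conditionally on the earlier answers, because those concern other edges. Once the whole tree is
  gone, the set is empty, \<open>A\<close> is tested on \<open>C\<^sub>1\<close> and \<open>B\<close> on
  \<open>C\<^sub>2\<close>, and independence gives the product.
\<close>

section \<open>Witnesses of increasing events\<close>

lemma fun_upd_in_configs_iff: "e \<in> E \<Longrightarrow> C(e := a) \<in> configs E \<longleftrightarrow> C(e := b) \<in> configs E"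
  by (auto simp: configs_def)

text \<open>
  Lowering a configuration to the smaller values on the witness keeps it in the event; closure
  upward then brings it back. Only the values on the witness are compared, so the lemma also
  transports a witness between configurations that differ elsewhere.
\<close>
lemma witness_mono:
  assumes "closed_upward E A" and "witness E A C I" and "\<And>f. f \<in> I \<Longrightarrow> C f \<le> C' f"
  shows "witness E A C' I"
  unfolding witness_def
proof (intro conjI ballI impI)
  show "I \<subseteq> E" using assms(2) by (simp add: witness_def)
  fix D assume D: "D \<in> configs E" "\<forall>f\<in>I. D f = C' f"
  \<comment> \<open>The configuration below \<open>D\<close> that agrees with \<open>C\<close> on \<open>I\<close>.\<close>
  define D' where "D' = (\<lambda>f. if f \<in> I then C f else D f)"
  have "D' \<in> configs E"
    using D(1) \<open>I \<subseteq> E\<close> by (auto simp: configs_def D'_def)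
  then have "D' \<in> A"
    using assms(2) by (auto simp: witness_def D'_def)
  moreover have "D' \<le> D"
    using assms(3) D(2) by (auto simp: le_fun_def D'_def)
  ultimately show "D \<in> A"
    using assms(1) D(1) unfolding closed_upward_def by blast
qed

text \<open>
  Knowing that an edge is closed cannot help an increasing event: a configuration in which that
  edge is open lies above one that matches the whole witness.
\<close>
lemma witness_remove_closed_edge:
  assumes "closed_upward E A" and "witness E A C I" and "\<not> C e"
  shows "witness E A C (I - {e})"
  unfolding witness_def
proof (intro conjI ballI impI)
  show "I - {e} \<subseteq> E" using assms(2) by (auto simp: witness_def)
  fix D assume D: "D \<in> configs E" "\<forall>f\<in>I - {e}. D f = C f"
  have "D(e := False) \<in> configs E"
    using D(1) by (auto simp: configs_def)
  then have "D(e := False) \<in> A"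
    using assms(2,3) D(2) by (auto simp: witness_def)
  moreover have "D(e := False) \<le> D"
    by (auto simp: le_fun_def)
  ultimately show "D \<in> A"
    using assms(1) D(1) unfolding closed_upward_def by blast
qed

section \<open>Removing one edge from the shared set\<close>

abbreviation static_box ::
    "'e set \<Rightarrow> 'e config set \<Rightarrow> 'e config set \<Rightarrow> 'e set \<Rightarrow> ('e config \<times> 'e config) set" where
  "static_box E A B S \<equiv> box_event E (\<lambda>_ _. S) A B"

text \<open>
  Since \<open>e\<close> lies in the shared set, both events see the closed value \<open>C1 e\<close>, so
  \<open>e\<close> can be dropped from both witnesses. They then survive any change of the values at
  \<open>e\<close>.
\<close>
lemma static_box_unshare_closed_edge:
  assumes up: "closed_upward E A" "closed_upward E B" and e: "e \<in> E" 
    and box: "(C1(e := False), C2(e := b)) \<in> static_box E A B (insert e S)"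
  shows "(C1(e := a'), C2(e := b')) \<in> static_box E A B S"
proof -
  from box obtain I J
    where conf: "C1(e := False) \<in> configs E" "C2(e := b) \<in> configs E"
      and I: "witness E A (C1(e := False)) I"
      and J: "witness E B (splice (insert e S) (C1(e := False)) (C2(e := b))) J"
      and IJ: "I \<inter> J \<subseteq> E - insert e S"
    by (auto simp: box_event_def)
  have "witness E A (C1(e := a')) (I - {e})"
    by (rule witness_mono[OF up(1) witness_remove_closed_edge[OF up(1) I, of e]]) auto
  moreover have "witness E B (splice S (C1(e := a')) (C2(e := b'))) (J - {e})"
    by (rule witness_mono[OF up(2) witness_remove_closed_edge[OF up(2) J, of e]])
      (auto simp: splice_def)
  moreover have "(I - {e}) \<inter> (J - {e}) \<subseteq> E - S" using IJ by blast
  moreover have "C1(e := a') \<in> configs E" "C2(e := b') \<in> configs E"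
    using conf e fun_upd_in_configs_iff by metis+
  ultimately show ?thesis
    unfolding box_event_def by blast
qed

text \<open>
  Disjointness at the shared edge \<open>e\<close> means that at most one event relies on \<open>e\<close>.
  If it is \<open>A\<close> (or neither), only the value in the first configuration matters once
  \<open>e\<close> has left the shared set; if it is \<open>B\<close>, only the value in the second one.
\<close>
lemma static_box_unshare_open_edge:
  assumes up: "closed_upward E A" "closed_upward E B" and e: "e \<in> E" "e \<notin> S"
    and box: "(C1(e := True), C2(e := b)) \<in> static_box E A B (insert e S)"
  shows "(\<forall>b'. (C1(e := True), C2(e := b')) \<in> static_box E A B S) \<or>
         (\<forall>a'. (C1(e := a'), C2(e := True)) \<in> static_box E A B S)"
proof -
  from box obtain I J
    where conf: "C1(e := True) \<in> configs E" "C2(e := b) \<in> configs E"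
      and I: "witness E A (C1(e := True)) I"
      and J: "witness E B (splice (insert e S) (C1(e := True)) (C2(e := b))) J"
      and IJ: "I \<inter> J \<subseteq> E - insert e S"
    by (auto simp: box_event_def)
  have conf': "C1(e := a') \<in> configs E" "C2(e := b') \<in> configs E" for a' b'
    using conf e fun_upd_in_configs_iff by metis+
  have IJ': "I \<inter> J \<subseteq> E - S" using IJ by blast
  show ?thesis
  proof (cases "e \<in> J")
    case False
    have "witness E B (splice S (C1(e := True)) (C2(e := b'))) J" for b'
      by (rule witness_mono[OF up(2) J]) (use False in \<open>auto simp: splice_def\<close>)
    then have "(C1(e := True), C2(e := b')) \<in> static_box E A B S" for b'
      using I IJ' conf' unfolding box_event_def by blast
    then show ?thesis by blast
  next
    case True
    then have "e \<notin> I" using IJ by blast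
    have "witness E A (C1(e := a')) I" for a'
      by (rule witness_mono[OF up(1) I]) (use \<open>e \<notin> I\<close> in auto)
    moreover have "witness E B (splice S (C1(e := a')) (C2(e := True))) J" for a'
      by (rule witness_mono[OF up(2) J]) (use e in \<open>auto simp: splice_def\<close>)
    ultimately have "(C1(e := a'), C2(e := True)) \<in> static_box E A B S" for a'
      using IJ' conf' unfolding box_event_def by blast
    then show ?thesis by blast
  qed
qed

text \<open>
  The comparison for two independent values \<open>(a, b)\<close> of one edge, abstracted from witnesses:
  \<open>X\<close> stands for the box event while the edge is shared, \<open>Y\<close> for the one after its
  removal. When \<open>X\<close> occurs only for \<open>a\<close> open, it has at most the probability that a
  single edge is open, and \<open>Y\<close> contains an event of exactly that probability. The predicate
  \<open>F\<close>, constant on the fibre, is the conditioning on the other edges.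
\<close>
lemma fibre_prob_le:
  fixes r :: "bool pmf"
  assumes F: "\<And>a b. F (a, b) \<longleftrightarrow> F0"
    and closed: "\<And>b a' b'. X (False, b) \<Longrightarrow> Y (a', b')"
    and opened: "\<And>b. X (True, b) \<Longrightarrow> (\<forall>b'. Y (True, b')) \<or> (\<forall>a'. Y (a', True))"
  shows "measure_pmf.prob (pair_pmf r r) {x. F x \<and> X x} \<le> measure_pmf.prob (pair_pmf r r) {x. F x \<and> Y x}"
proof (cases "F0 \<and> (\<exists>b. X (False, b))")
  case True
  then have "{x. F x \<and> Y x} = UNIV" using F closed by auto
  then show ?thesis by (simp add: measure_pmf.prob_le_1)
next
  case False
  let ?q = "measure_pmf.prob r {True}"
  have fst: "measure_pmf.prob (pair_pmf r r) (fst -` {True}) = ?q"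
    by (metis map_fst_pair_pmf measure_map_pmf)
  have snd: "measure_pmf.prob (pair_pmf r r) (snd -` {True}) = ?q"
    by (metis map_snd_pair_pmf measure_map_pmf)
  show ?thesis
  proof (cases "F0 \<and> (\<exists>b. X (True, b))")
    case True
    have "measure_pmf.prob (pair_pmf r r) {x. F x \<and> X x} \<le> ?q"
    proof -
      have "F x \<and> X x \<Longrightarrow> x \<in> fst -` {True}" for x
        using False F by (cases x; cases "fst x") auto
      then have "{x. F x \<and> X x} \<subseteq> fst -` {True}" by blast
      then show ?thesis
        unfolding fst[symmetric] by (intro measure_pmf.finite_measure_mono) auto
    qed
    moreover have "?q \<le> measure_pmf.prob (pair_pmf r r) {x. F x \<and> Y x}"
    proof -
      from True obtain b where "F0" "X (True, b)" by blast
      from opened[OF this(2)] show ?thesis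
      proof
        assume "\<forall>b'. Y (True, b')"
        then show ?thesis
          unfolding fst[symmetric] using F \<open>F0\<close> by (intro measure_pmf.finite_measure_mono) auto
      next
        assume "\<forall>a'. Y (a', True)"
        then show ?thesis
          unfolding snd[symmetric] using F \<open>F0\<close> by (intro measure_pmf.finite_measure_mono) auto
      qed
    qed
    ultimately show ?thesis by linarith
  next
    case none: False
    have "\<not> (F (a, b) \<and> X (a, b))" for a b
      using none False F by (cases a) auto
    then have "{x. F x \<and> X x} = {}" by auto
    then show ?thesis by (simp only: measure_empty measure_nonneg)
  qed
qed

section \<open>Conditioning on all edges but one\<close>

text \<open>
  Resampling one edge preserves the percolation measure. This replaces conditioning on the other
  edges: an inequality that holds after resampling from every pair of configurations holds for the
  measure itself.
\<close>
lemma percolation_resample: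
  assumes "finite E" "e \<in> E"
  shows "percolation E p =
    bind_pmf (percolation E p) (\<lambda>C. map_pmf (\<lambda>a. C(e := a)) (bernoulli_pmf (p e)))"
proof -
  have E: "E = insert e (E - {e})" using assms by blast
  have "percolation E p = bind_pmf (bernoulli_pmf (p e)) (\<lambda>a.
      map_pmf (\<lambda>C. C(e := a)) (percolation (E - {e}) p))" (is "_ = ?R")
    unfolding percolation_def
    using assms Pi_pmf_insert'[of "E - {e}" e False "\<lambda>e. bernoulli_pmf (p e)"] E
    by (simp add: map_pmf_def)
  moreover have "bind_pmf ?R (\<lambda>C. map_pmf (\<lambda>a. C(e := a)) (bernoulli_pmf (p e))) = ?R"
    by (simp add: bind_assoc_pmf bind_map_pmf map_pmf_def bind_return_pmf)
      (rule bind_commute_pmf)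
  ultimately show ?thesis by metis
qed

definition two_copies :: "'e set \<Rightarrow> ('e \<Rightarrow> real) \<Rightarrow> ('e config \<times> 'e config) pmf" where
  "two_copies E p = pair_pmf (percolation E p) (percolation E p)"

lemma two_copies_resample:
  assumes "finite E" "e \<in> E"
  shows "two_copies E p =
    bind_pmf (two_copies E p) (\<lambda>(C1, C2). map_pmf (\<lambda>(a, b). (C1(e := a), C2(e := b)))
      (pair_pmf (bernoulli_pmf (p e)) (bernoulli_pmf (p e))))"
  (is "_ = ?R")
proof -
  let ?P = "percolation E p" and ?r = "bernoulli_pmf (p e)"
  let ?K = "\<lambda>C. map_pmf (\<lambda>a. C(e := a)) ?r"
  have "two_copies E p = pair_pmf (bind_pmf ?P ?K) (bind_pmf ?P ?K)"
    using percolation_resample[OF assms, of p] by (simp add: two_copies_def)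
  also have "\<dots> = bind_pmf ?P (\<lambda>C1. bind_pmf ?r (\<lambda>a. bind_pmf ?P (\<lambda>C2. bind_pmf ?r (\<lambda>b.
      return_pmf (C1(e := a), C2(e := b))))))"
    by (simp add: pair_pmf_def bind_assoc_pmf map_pmf_def bind_return_pmf)
  also have "\<dots> = bind_pmf ?P (\<lambda>C1. bind_pmf ?P (\<lambda>C2. bind_pmf ?r (\<lambda>a. bind_pmf ?r (\<lambda>b.
      return_pmf (C1(e := a), C2(e := b))))))"
    by (subst (2) bind_commute_pmf) (rule refl)
  also have "\<dots> = ?R"
    by (simp add: two_copies_def pair_pmf_def bind_assoc_pmf map_pmf_def bind_return_pmf)
  finally show ?thesis .
qed

lemma two_copies_prob_le_fibrewise:
  assumes "finite E" "e \<in> E"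
    and fibre: "\<And>C1 C2.
      measure_pmf.prob (pair_pmf (bernoulli_pmf (p e)) (bernoulli_pmf (p e)))
        {(a, b). (C1(e := a), C2(e := b)) \<in> X}
      \<le> measure_pmf.prob (pair_pmf (bernoulli_pmf (p e)) (bernoulli_pmf (p e)))
        {(a, b). (C1(e := a), C2(e := b)) \<in> Y}"
  shows "measure_pmf.prob (two_copies E p) X \<le> measure_pmf.prob (two_copies E p) Y"
proof -
  let ?K = "\<lambda>(C1, C2). map_pmf (\<lambda>(a, b). (C1(e := a), C2(e := b)))
      (pair_pmf (bernoulli_pmf (p e)) (bernoulli_pmf (p e)))"
  have fibre': "emeasure (?K x) X \<le> emeasure (?K x) Y" for x
    using fibre[of "fst x" "snd x"]
    by (cases x) (simp add: measure_pmf.emeasure_eq_measure vimage_def case_prod_unfold)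
  have "emeasure (two_copies E p) X = (\<integral>\<^sup>+x. emeasure (?K x) X \<partial>two_copies E p)"
    by (subst two_copies_resample[OF assms(1,2)]) (rule emeasure_bind_pmf)
  also have "\<dots> \<le> (\<integral>\<^sup>+x. emeasure (?K x) Y \<partial>two_copies E p)"
    by (intro nn_integral_mono fibre')
  also have "\<dots> = emeasure (two_copies E p) Y"
    by (subst (2) two_copies_resample[OF assms(1,2)]) (rule emeasure_bind_pmf[symmetric])
  finally show ?thesis
    by (simp add: measure_pmf.emeasure_eq_measure)
qed

section \<open>Dismantling the decision tree\<close>

definition insensitive :: "'e set \<Rightarrow> ('e config \<times> 'e config) set \<Rightarrow> bool" where
  "insensitive U F \<longleftrightarrow> (\<forall>C1 C2. \<forall>e\<in>U. \<forall>a b.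
     (C1(e := a), C2(e := b)) \<in> F \<longleftrightarrow> (C1, C2) \<in> F)"

text \<open>
  The event \<open>F\<close> records the answers already given by the tree. It has to be insensitive to
  \<open>e\<close>, since otherwise resampling \<open>e\<close> would change the condition.
\<close>
lemma static_box_prob_unshare_edge:
  assumes "finite E" and e: "e \<in> E" and up: "closed_upward E A" "closed_upward E B"
    and F: "insensitive {e} F"
  shows "measure_pmf.prob (two_copies E p) (F \<inter> static_box E A B (insert e S))
    \<le> measure_pmf.prob (two_copies E p) (F \<inter> static_box E A B S)"
proof (cases "e \<in> S")
  case True
  then show ?thesis by (simp add: insert_absorb)
next
  case False
  show ?thesis
  proof (rule two_copies_prob_le_fibrewise[OF assms(1) e])
    fix C1 C2 :: "'a config"
    let ?r = "bernoulli_pmf (p e)" and ?f = "\<lambda>(a, b). (C1(e := a), C2(e := b))"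
    have "measure_pmf.prob (pair_pmf ?r ?r)
        {x. ?f x \<in> F \<and> ?f x \<in> static_box E A B (insert e S)}
      \<le> measure_pmf.prob (pair_pmf ?r ?r) {x. ?f x \<in> F \<and> ?f x \<in> static_box E A B S}"
    proof (rule fibre_prob_le)
      show "?f (a, b) \<in> F \<longleftrightarrow> (C1, C2) \<in> F" for a b
        using F by (auto simp: insensitive_def)
    qed (use static_box_unshare_closed_edge[OF up e]
          static_box_unshare_open_edge[OF up e False] in auto)
    then show "measure_pmf.prob (pair_pmf ?r ?r)
        {(a, b). (C1(e := a), C2(e := b)) \<in> F \<inter> static_box E A B (insert e S)}
      \<le> measure_pmf.prob (pair_pmf ?r ?r)
        {(a, b). (C1(e := a), C2(e := b)) \<in> F \<inter> static_box E A B S}"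
      by (simp add: case_prod_unfold)
  qed
qed

text \<open>
  Passing to \<open>U - {e}\<close> is where the distinctness of the queries on a path enters: the subtree
  never looks at \<open>e\<close> again, so the answer at \<open>e\<close> is a legitimate condition for it.
\<close>
lemma decision_tree_child:
  assumes "decision_tree U (Decision e d ch)"
  shows "e \<in> U" and "decision_tree (U - {e}) (ch r)"
proof -
  have path: "set (e # es) \<subseteq> U \<and> distinct (e # es)" if "es \<in> root_paths (ch r)" for es r
  proof -
    have "e # es \<in> root_paths (Decision e d ch)"
      using that by (simp only: root_paths.simps) blast
    then show ?thesis using assms unfolding decision_tree_def by blast
  qed
  show "decision_tree (U - {e}) (ch r)"
    unfolding decision_tree_def using path[of _ r] by auto
  have "root_paths t \<noteq> {}" for t :: "'a query_tree"
    by (induction t) auto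
  then obtain es where "es \<in> root_paths (ch r)" by blast
  then show "e \<in> U" using path by auto
qed

lemma prob_eq_sum_fibres:
  fixes g :: "'a \<Rightarrow> 'b :: finite"
  shows "measure_pmf.prob M X = (\<Sum>r\<in>UNIV. measure_pmf.prob M (X \<inter> g -` {r}))"
proof -
  have "measure_pmf.prob M (\<Union>r. X \<inter> g -` {r}) = (\<Sum>r\<in>UNIV. measure_pmf.prob M (X \<inter> g -` {r}))"
    by (rule measure_pmf.finite_measure_finite_Union) (auto simp: disjoint_family_on_def)
  moreover have "(\<Union>r. X \<inter> g -` {r}) = X" by auto
  ultimately show ?thesis by simp
qed

text \<open>
  The induction runs over the tree with the set \<open>S\<close> collected so far and the answers \<open>F\<close>
  received so far both arbitrary. At a decision node the event is split by the four answers at the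
  queried edge \<open>e\<close>. Within each answer the induction hypothesis replaces the child by the empty
  tree; the resulting set is the same for all four answers, so the parts add up to a static box
  event, from which \<open>e\<close>, in case it was put into the set, is removed by \<open>static_box_prob_unshare_edge\<close>.
\<close>
lemma box_tree_le_static_box:
  assumes "finite E" and up: "closed_upward E A" "closed_upward E B"
    and "decision_tree U T" and "U \<subseteq> E" and "insensitive U F"
  shows "measure_pmf.prob (two_copies E p)
      (F \<inter> box_event E (\<lambda>C1 C2. S \<union> built_set T C1 C2) A B)
    \<le> measure_pmf.prob (two_copies E p) (F \<inter> static_box E A B S)"
  using assms(4-6)
proof (induction T arbitrary: U F S)
  case (Leaf e d)
  then have "e \<in> E" "insensitive {e} F"
    by (auto simp: decision_tree_def insensitive_def)
  then show ?case
    using static_box_prob_unshare_edge[OF assms(1) _ up, of e F p S] by (cases d) auto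
next
  case (Decision e d ch)
  let ?P = "measure_pmf.prob (two_copies E p)"
  let ?T = "box_event E (\<lambda>C1 C2. S \<union> built_set (Decision e d ch) C1 C2) A B"
  define S' where "S' = (if d = To_S then insert e S else S)"
  define g :: "'a config \<times> 'a config \<Rightarrow> bool \<times> bool" where "g = (\<lambda>(C1, C2). (C1 e, C2 e))"
  have "e \<in> U" and child: "decision_tree (U - {e}) (ch r)" for r
    using decision_tree_child[OF Decision.prems(1)] by auto
  then have e: "e \<in> E" "insensitive {e} F"
    using Decision.prems by (auto simp: insensitive_def)
  have "?P (F \<inter> ?T) = (\<Sum>r\<in>UNIV. ?P ((F \<inter> ?T) \<inter> g -` {r}))"
    by (rule prob_eq_sum_fibres)
  also have "\<dots> \<le> (\<Sum>r\<in>UNIV. ?P ((F \<inter> static_box E A B S') \<inter> g -` {r}))"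
  proof (rule sum_mono)
    fix r
    have "insensitive (U - {e}) (F \<inter> g -` {r})"
      using Decision.prems(3) by (auto simp: insensitive_def g_def)
    then have "?P ((F \<inter> g -` {r}) \<inter> box_event E (\<lambda>C1 C2. S' \<union> built_set (ch r) C1 C2) A B)
        \<le> ?P ((F \<inter> g -` {r}) \<inter> static_box E A B S')"
      using Decision.prems(2) by (intro Decision.IH[OF _ child]) auto
    moreover have "(F \<inter> ?T) \<inter> g -` {r} =
        (F \<inter> g -` {r}) \<inter> box_event E (\<lambda>C1 C2. S' \<union> built_set (ch r) C1 C2) A B"
      by (auto simp: g_def S'_def box_event_def)
    ultimately show "?P ((F \<inter> ?T) \<inter> g -` {r}) \<le> ?P ((F \<inter> static_box E A B S') \<inter> g -` {r})"
      by (simp add: Int_ac)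
  qed
  also have "\<dots> = ?P (F \<inter> static_box E A B S')"
    by (rule prob_eq_sum_fibres[symmetric])
  also have "\<dots> \<le> ?P (F \<inter> static_box E A B S)"
    using static_box_prob_unshare_edge[OF assms(1) e(1) up e(2)] by (simp add: S'_def)
  finally show ?case .
qed

section \<open>The inequality\<close>

lemma static_box_empty_subset: "static_box E A B {} \<subseteq> A \<times> B"
  by (auto simp: box_event_def witness_def splice_def)

lemma finite_configs: "finite E \<Longrightarrow> finite (configs E)"
proof -
  assume "finite E"
  have "configs E \<subseteq> (\<lambda>X e. e \<in> X) ` Pow E"
  proof
    fix C assume "C \<in> configs E"
    then show "C \<in> (\<lambda>X e. e \<in> X) ` Pow E"
      by (intro image_eqI[of _ _ "{e. C e}"]) (auto simp: configs_def)
  qed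
  then show ?thesis using \<open>finite E\<close> by (meson finite_Pow_iff finite_imageI finite_subset)
qed

theorem theorem4p3:
  fixes V :: "'v set" and E :: "'v set set" and p :: "'v set \<Rightarrow> real"
    and T :: "'v set query_tree" and A B :: "'v set config set"
  assumes "finite V" and "simple_graph V E" and "connected_graph V E"
    and "\<And>e. e \<in> E \<Longrightarrow> 0 \<le> p e \<and> p e \<le> 1"
    and "decision_tree E T"
    and "A \<subseteq> configs E" and "closed_upward E A"
    and "B \<subseteq> configs E" and "closed_upward E B"
  shows "measure_pmf.prob (pair_pmf (percolation E p) (percolation E p)) (box_event E (built_set T) A B)
    \<le> measure_pmf.prob (percolation E p) A * measure_pmf.prob (percolation E p) B"
proof -
  have "E \<subseteq> Pow V" using assms(2) by (auto simp: simple_graph_def)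
  then have E: "finite E" using assms(1) by (simp add: finite_subset)
  have "measure_pmf.prob (two_copies E p) (box_event E (built_set T) A B)
      \<le> measure_pmf.prob (two_copies E p) (static_box E A B {})"
    using box_tree_le_static_box[OF E assms(7,9,5) order_refl, of UNIV p "{}"]
    by (simp add: insensitive_def)
  also have "\<dots> \<le> measure_pmf.prob (two_copies E p) (A \<times> B)"
    by (intro measure_pmf.finite_measure_mono static_box_empty_subset) auto
  also have "\<dots> = measure_pmf.prob (percolation E p) A * measure_pmf.prob (percolation E p) B"
    unfolding two_copies_def
    by (rule measure_pmf_prob_product)
      (use finite_configs[OF E] assms(6,8) in \<open>auto intro: countable_finite finite_subset\<close>)
  finally show ?thesis by (simp add: two_copies_def)
qed

end
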